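(* Let $\delta\neq0$, and let $\varphi:(x,y)\mapsto(\bar x,\bar y)$ be the system on $\mathbb{P}^1\times\mathbb{P}^1$ $$\bar x=-\frac{xy\big(\sinh(\gamma-z)+\sinh(\gamma+z)\big)-\sinh(2z)\big(x^2+\delta^2\sinh(\gamma-z)\sinh(\gamma+z)\big)}{x\big(\sinh(\gamma-z)+\sinh(\gamma+z)\big)-y\sinh(2z)},\qquad \bar y=x .$$ Then the pencil of curves $$c_1\delta^2(x\sinh\gamma-y\sinh z)(y\sinh\gamma-x\sinh z)+c_2\big[(\sinh^2\gamma+\sinh^2z)\delta^2-(x^2+y^2)\big]=0$$ is preserved by $\varphi$. If one puts $$s=\frac{c_1}{c_2}=\frac{x^2+y^2-\delta^2(\sinh^2\gamma+\sinh^2z)}{\delta^2(x\sinh z-y\sinh\gamma)(y\sinh z-x\sinh\gamma)},\qquad t=\frac{y-\delta\sinh\gamma}{x-\delta\sinh z},$$ then $$\bar s=\frac{16\sinh z\,\sinh\gamma-s\,\delta^2(\cosh2\gamma-\cosh2z)^2}{\delta^2(\cosh2\gamma-\cosh2z)^2\,(s\,\delta^2\sinh z\,\sinh\gamma+1)},\qquad \bar t=\frac{a_0+a_1t}{a_2+a_3t},$$ where $$a_0=\sinh z\,(s\delta^2\cosh2\gamma-s\delta^2+2)-2s\delta^2\sinh^3\gamma+2\sinh\gamma,$$ $$a_1=(\sinh\gamma-\sinh z)(2s\delta^2\sinh z\,\sinh\gamma+2),$$ $$a_2=\sinh z\,\big(-s\delta^2(\cosh2z-2\sinh z\,\sinh\gamma)+s\delta^2+2\big)+2\sinh\gamma,$$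 $$a_3=2(\sinh z-\sinh\gamma)(s\delta^2\sinh z\,\sinh\gamma+1),$$ and $\bar s,\bar t$ denote $s,t$ evaluated at $(\bar x,\bar y)=\varphi(x,y)$. This system for $(s,t)$ can be solved in cascade, as discrete Riccati equations.
   Context: The map $\varphi$ is the system form ($x=\bar u$, $y=u$, with parameters $\alpha=\gamma-z$, $\beta=\gamma+z$) of the second-order equation $$(\sinh\alpha+\sinh\beta)(u\bar u+\bar u\bar{\bar u})+\sinh(\alpha-\beta)\big(u\bar{\bar u}+\bar u^2+\delta^2\sinh\alpha\sinh\beta\big)=0,$$ which is the reduction $\hat u=-\bar u$ of the lattice equation $Q3_\delta$: $\sinh(\alpha)(u\bar u+\hat u\hat{\bar u})-\sinh(\beta)(u\hat u+\bar u\hat{\bar u})-\sinh(\alpha-\beta)(\hat u\bar u+u\hat{\bar u}-\delta^2\sinh\alpha\sinh\beta)=0$, where $u=u(k,l)$, $\bar u=u(k+1,l)$, $\hat u=u(k,l+1)$, $\hat{\bar u}=u(k+1,l+1)$, $\bar{\bar u}=u(k+2,l)$. A discrete Riccati equation is a first-order recursion in which the new value is a fractional linear function of the old value; "solved in cascade" means that the first equation involves only $s$ and the second is Riccati in $t$ with coefficients depending on $s$. *)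

theory Defs
  imports "HOL-Analysis.Analysis" "HOL-Library.Infinite_Set"
begin

section \<open>The projective line and rational maps\<close>

datatype P1 = Fin complex | Infty

text \<open>Homogeneous coordinates: \<open>hc x = (x1, x0)\<close> represents the point \<open>x1 / x0\<close>.\<close>

fun hc :: "P1 \<Rightarrow> complex \<times> complex" where
  "hc (Fin a) = (a, 1)"
| "hc Infty = (1, 0)"

text \<open>The point \<open>a / b\<close> of the projective line; \<open>0 / 0\<close> is indeterminate.
  Rational maps are partial functions, with value \<open>None\<close> at their points of indeterminacy.\<close>

definition ratio :: "complex \<Rightarrow> complex \<Rightarrow> P1 option" where
  "ratio a b =
     (if b \<noteq> 0 then Some (Fin (a / b)) else if a \<noteq> 0 then Some Infty else None)"

text \<open>Equality of two rational maps wherever both are determinate.\<close>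

definition agree :: "('a \<Rightarrow> 'b option) \<Rightarrow> ('a \<Rightarrow> 'b option) \<Rightarrow> bool" where
  "agree f g \<longleftrightarrow> (\<forall>p. f p \<noteq> None \<longrightarrow> g p \<noteq> None \<longrightarrow> f p = g p)"

definition generically_defined :: "(P1 \<times> P1 \<Rightarrow> 'b option) \<Rightarrow> bool" where
  "generically_defined f \<longleftrightarrow> (MOST x. MOST y. f (Fin x, Fin y) \<noteq> None)"


section \<open>The map and the pencil\<close>

text \<open>Each formula is the bihomogenization of the affine one,
  with \<open>x = x1 / x0\<close> and \<open>y = y1 / y0\<close>; cf. the affine lemmas at the end.\<close>

definition phi :: "complex \<Rightarrow> complex \<Rightarrow> complex \<Rightarrow> P1 \<times> P1 \<Rightarrow> (P1 \<times> P1) option" where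
  "phi \<delta> \<gamma> z = (\<lambda>(x, y).
     let (x1, x0) = hc x; (y1, y0) = hc y in
     map_option (\<lambda>xb. (xb, x))
       (ratio
         (- (x0 * x1 * y1 * (sinh (\<gamma> - z) + sinh (\<gamma> + z))
             - sinh (2 * z) * y0 * (x1\<^sup>2 + \<delta>\<^sup>2 * sinh (\<gamma> - z) * sinh (\<gamma> + z) * x0\<^sup>2)))
         (x0 * (x1 * y0 * (sinh (\<gamma> - z) + sinh (\<gamma> + z)) - x0 * y1 * sinh (2 * z)))))"

text \<open>The member of the pencil with parameter \<open>c = c1 / c2\<close>.\<close>

definition pencil_curve :: "complex \<Rightarrow> complex \<Rightarrow> complex \<Rightarrow> P1 \<Rightarrow> (P1 \<times> P1) set" where
  "pencil_curve \<delta> \<gamma> z c = {(x, y).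
     let (c1, c2) = hc c; (x1, x0) = hc x; (y1, y0) = hc y in
     c1 * \<delta>\<^sup>2 * (x1 * y0 * sinh \<gamma> - x0 * y1 * sinh z) * (x0 * y1 * sinh \<gamma> - x1 * y0 * sinh z)
     + c2 * (((sinh \<gamma>)\<^sup>2 + (sinh z)\<^sup>2) * \<delta>\<^sup>2 * x0\<^sup>2 * y0\<^sup>2 - (x1\<^sup>2 * y0\<^sup>2 + x0\<^sup>2 * y1\<^sup>2)) = 0}"

text \<open>The curve with parameter \<open>c\<close> is mapped into the one with parameter \<open>\<sigma> c\<close>.\<close>

definition acts_on_pencil ::
  "('a \<Rightarrow> 'a option) \<Rightarrow> ('c \<Rightarrow> 'a set) \<Rightarrow> ('c \<Rightarrow> 'c) \<Rightarrow> bool" where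
  "acts_on_pencil f C \<sigma> \<longleftrightarrow> (\<forall>c. \<forall>p\<in>C c. \<forall>q. f p = Some q \<longrightarrow> q \<in> C (\<sigma> c))"


section \<open>The coordinates \<open>s\<close>, \<open>t\<close> and their evolution\<close>

definition s_fun :: "complex \<Rightarrow> complex \<Rightarrow> complex \<Rightarrow> P1 \<times> P1 \<Rightarrow> P1 option" where
  "s_fun \<delta> \<gamma> z = (\<lambda>(x, y).
     let (x1, x0) = hc x; (y1, y0) = hc y in
     ratio
       (x1\<^sup>2 * y0\<^sup>2 + x0\<^sup>2 * y1\<^sup>2 - \<delta>\<^sup>2 * ((sinh \<gamma>)\<^sup>2 + (sinh z)\<^sup>2) * x0\<^sup>2 * y0\<^sup>2)
       (\<delta>\<^sup>2 * (x1 * y0 * sinh z - x0 * y1 * sinh \<gamma>) * (x0 * y1 * sinh z - x1 * y0 * sinh \<gamma>)))"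

definition t_fun :: "complex \<Rightarrow> complex \<Rightarrow> complex \<Rightarrow> P1 \<times> P1 \<Rightarrow> P1 option" where
  "t_fun \<delta> \<gamma> z = (\<lambda>(x, y).
     let (x1, x0) = hc x; (y1, y0) = hc y in
     ratio (x0 * (y1 - \<delta> * sinh \<gamma> * y0)) (y0 * (x1 - \<delta> * sinh z * x0)))"

definition s_next :: "complex \<Rightarrow> complex \<Rightarrow> complex \<Rightarrow> P1 \<Rightarrow> P1 option" where
  "s_next \<delta> \<gamma> z s =
     (let (s1, s0) = hc s in
      ratio
        (16 * sinh z * sinh \<gamma> * s0 - s1 * \<delta>\<^sup>2 * (cosh (2 * \<gamma>) - cosh (2 * z))\<^sup>2)
        (\<delta>\<^sup>2 * (cosh (2 * \<gamma>) - cosh (2 * z))\<^sup>2 * (s1 * \<delta>\<^sup>2 * sinh z * sinh \<gamma> + s0)))"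

text \<open>The coefficients are affine in \<open>s\<close>; they are homogenized with \<open>s = s1 / s0\<close>, so that
  \<open>s = Infty\<close> is covered too.\<close>

definition t_next :: "complex \<Rightarrow> complex \<Rightarrow> complex \<Rightarrow> P1 \<Rightarrow> P1 \<Rightarrow> P1 option" where
  "t_next \<delta> \<gamma> z s t =
     (let (s1, s0) = hc s; (t1, t0) = hc t;
          a0 = sinh z * (s1 * \<delta>\<^sup>2 * cosh (2 * \<gamma>) - s1 * \<delta>\<^sup>2 + 2 * s0)
               - 2 * s1 * \<delta>\<^sup>2 * (sinh \<gamma>) ^ 3 + 2 * s0 * sinh \<gamma>;
          a1 = (sinh \<gamma> - sinh z) * (2 * s1 * \<delta>\<^sup>2 * sinh z * sinh \<gamma> + 2 * s0);
          a2 = sinh z * (- s1 * \<delta>\<^sup>2 * (cosh (2 * z) - 2 * sinh z * sinh \<gamma>) + s1 * \<delta>\<^sup>2 + 2 * s0)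
               + 2 * s0 * sinh \<gamma>;
          a3 = 2 * (sinh z - sinh \<gamma>) * (s1 * \<delta>\<^sup>2 * sinh z * sinh \<gamma> + s0)
      in ratio (a0 * t0 + a1 * t1) (a2 * t0 + a3 * t1))"


section \<open>Discrete Riccati equations\<close>

text \<open>The fractional linear function \<open>t \<mapsto> (a + b t) / (c + d t)\<close>.\<close>

definition frac_lin ::
  "complex \<Rightarrow> complex \<Rightarrow> complex \<Rightarrow> complex \<Rightarrow> P1 \<Rightarrow> P1 option" where
  "frac_lin a b c d t = (let (t1, t0) = hc t in ratio (a * t0 + b * t1) (c * t0 + d * t1))"

definition discrete_riccati :: "(P1 \<Rightarrow> P1 option) \<Rightarrow> bool" where
  "discrete_riccati f \<longleftrightarrow> (\<exists>a b c d. f = frac_lin a b c d)"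

definition nondegenerate_riccati :: "(P1 \<Rightarrow> P1 option) \<Rightarrow> bool" where
  "nondegenerate_riccati f \<longleftrightarrow> (\<exists>a b c d. a * d \<noteq> b * c \<and> f = frac_lin a b c d)"

text \<open>The system \<open>s' = S s\<close>, \<open>t' = T s t\<close>: the first equation involves \<open>s\<close> only, the second one is
  Riccati in \<open>t\<close> with coefficients depending on \<open>s\<close>.\<close>

definition riccati_cascade :: "(P1 \<Rightarrow> P1 option) \<Rightarrow> (P1 \<Rightarrow> P1 \<Rightarrow> P1 option) \<Rightarrow> bool" where
  "riccati_cascade S T \<longleftrightarrow> discrete_riccati S \<and> (\<forall>s. discrete_riccati (T s))"

text \<open>Excluded: \<open>cosh z = 0\<close>, where \<open>phi\<close> is \<open>0 / 0\<close> everywhere; equal squares, where the first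
  component of \<open>phi\<close> does not depend on \<open>y\<close>; opposite squares, where the two generators of the
  pencil are proportional.\<close>

definition nondegenerate :: "complex \<Rightarrow> complex \<Rightarrow> bool" where
  "nondegenerate \<gamma> z \<longleftrightarrow>
     cosh z \<noteq> 0 \<and> (sinh \<gamma>)\<^sup>2 \<noteq> (sinh z)\<^sup>2 \<and> (sinh \<gamma>)\<^sup>2 + (sinh z)\<^sup>2 \<noteq> 0"


section \<open>The affine formulas\<close>

lemma phi_affine:
  assumes "x * (sinh (\<gamma> - z) + sinh (\<gamma> + z)) - y * sinh (2 * z) \<noteq> 0"
  shows "phi \<delta> \<gamma> z (Fin x, Fin y) = Some (Fin
    (- (x * y * (sinh (\<gamma> - z) + sinh (\<gamma> + z))
        - sinh (2 * z) * (x\<^sup>2 + \<delta>\<^sup>2 * sinh (\<gamma> - z) * sinh (\<gamma> + z)))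
     / (x * (sinh (\<gamma> - z) + sinh (\<gamma> + z)) - y * sinh (2 * z))), Fin x)"
  using assms by (simp add: phi_def ratio_def)

lemma pencil_curve_affine:
  assumes "c2 \<noteq> 0"
  shows "(Fin x, Fin y) \<in> pencil_curve \<delta> \<gamma> z (Fin (c1 / c2)) \<longleftrightarrow>
    c1 * \<delta>\<^sup>2 * (x * sinh \<gamma> - y * sinh z) * (y * sinh \<gamma> - x * sinh z)
    + c2 * (((sinh \<gamma>)\<^sup>2 + (sinh z)\<^sup>2) * \<delta>\<^sup>2 - (x\<^sup>2 + y\<^sup>2)) = 0"
  using assms by (simp add: pencil_curve_def field_simps)

lemma pencil_curve_affine_Infty:
  assumes "c1 \<noteq> 0"
  shows "(Fin x, Fin y) \<in> pencil_curve \<delta> \<gamma> z Infty \<longleftrightarrow>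
    c1 * \<delta>\<^sup>2 * (x * sinh \<gamma> - y * sinh z) * (y * sinh \<gamma> - x * sinh z) = 0"
  using assms by (simp add: pencil_curve_def)

lemma s_fun_affine:
  assumes "\<delta>\<^sup>2 * (x * sinh z - y * sinh \<gamma>) * (y * sinh z - x * sinh \<gamma>) \<noteq> 0"
  shows "s_fun \<delta> \<gamma> z (Fin x, Fin y) = Some (Fin
    ((x\<^sup>2 + y\<^sup>2 - \<delta>\<^sup>2 * ((sinh \<gamma>)\<^sup>2 + (sinh z)\<^sup>2))
     / (\<delta>\<^sup>2 * (x * sinh z - y * sinh \<gamma>) * (y * sinh z - x * sinh \<gamma>))))"
  using assms by (simp add: s_fun_def ratio_def)

lemma t_fun_affine:
  assumes "x - \<delta> * sinh z \<noteq> 0"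
  shows "t_fun \<delta> \<gamma> z (Fin x, Fin y) = Some (Fin ((y - \<delta> * sinh \<gamma>) / (x - \<delta> * sinh z)))"
  using assms by (simp add: t_fun_def ratio_def)

lemma s_next_affine:
  assumes "\<delta>\<^sup>2 * (cosh (2 * \<gamma>) - cosh (2 * z))\<^sup>2 * (s * \<delta>\<^sup>2 * sinh z * sinh \<gamma> + 1) \<noteq> 0"
  shows "s_next \<delta> \<gamma> z (Fin s) = Some (Fin
    ((16 * sinh z * sinh \<gamma> - s * \<delta>\<^sup>2 * (cosh (2 * \<gamma>) - cosh (2 * z))\<^sup>2)
     / (\<delta>\<^sup>2 * (cosh (2 * \<gamma>) - cosh (2 * z))\<^sup>2 * (s * \<delta>\<^sup>2 * sinh z * sinh \<gamma> + 1))))"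
  using assms by (simp add: s_next_def ratio_def)

lemma t_next_affine:
  assumes "a0 = sinh z * (s * \<delta>\<^sup>2 * cosh (2 * \<gamma>) - s * \<delta>\<^sup>2 + 2)
                - 2 * s * \<delta>\<^sup>2 * (sinh \<gamma>) ^ 3 + 2 * sinh \<gamma>"
    and "a1 = (sinh \<gamma> - sinh z) * (2 * s * \<delta>\<^sup>2 * sinh z * sinh \<gamma> + 2)"
    and "a2 = sinh z * (- s * \<delta>\<^sup>2 * (cosh (2 * z) - 2 * sinh z * sinh \<gamma>) + s * \<delta>\<^sup>2 + 2)
                + 2 * sinh \<gamma>"
    and "a3 = 2 * (sinh z - sinh \<gamma>) * (s * \<delta>\<^sup>2 * sinh z * sinh \<gamma> + 1)"
    and "a2 + a3 * t \<noteq> 0"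
  shows "t_next \<delta> \<gamma> z (Fin s) (Fin t) = Some (Fin ((a0 + a1 * t) / (a2 + a3 * t)))"
  using assms(5) unfolding assms(1-4) by (simp add: t_next_def ratio_def Let_def)

end

theory Submission
  imports Defs
begin

text \<open>With \<open>g = sinh \<gamma>\<close>, \<open>k = sinh z\<close>, the common factor \<open>2 cosh z\<close> cancels from \<open>\<phi>\<close> and every
  map becomes a pair of bihomogeneous polynomials, so the evolution laws are polynomial identities.
  Write \<open>N / D\<close> for \<open>s\<close> and \<open>N' / D'\<close> for \<open>s\<close> after \<open>\<phi>\<close>. Then \<open>(N', D')\<close> is, up to the factor
  \<open>x0\<^sup>2 (k\<^sup>2 \<delta>\<^sup>2 x0\<^sup>2 - x1\<^sup>2) / (\<delta>\<^sup>2 (g\<^sup>2 + k\<^sup>2))\<close>, the image of \<open>(N, D)\<close> under the matrix of the Riccati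
  equation for \<open>s\<close>. This covers the base points of the pencil too. The matrix is traceless, so it acts
  on the pencil as an involution unless \<open>g\<^sup>2 = \<plusminus> k\<^sup>2\<close>; in these cases the image of \<open>\<phi>\<close> lies in a
  single member of the pencil.\<close>

section \<open>Homogeneous coordinates\<close>

definition rat :: "complex \<times> complex \<Rightarrow> P1 option" where
  "rat v = ratio (fst v) (snd v)"

definition scale :: "complex \<Rightarrow> complex \<times> complex \<Rightarrow> complex \<times> complex" where
  "scale m v = (m * fst v, m * snd v)"

text \<open>A determinant that vanishes exactly when the vectors are proportional, so equality of
  points becomes a polynomial identity. The zero vector is proportional to everything, hence
  indeterminate values need separate care.\<close>

definition cross :: "complex \<times> complex \<Rightarrow> complex \<times> complex \<Rightarrow> complex" where
  "cross v w = fst v * snd w - snd v * fst w"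

lemma rat_eq_None_iff: "rat v = None \<longleftrightarrow> v = (0, 0)"
  by (cases v) (simp add: rat_def ratio_def)

lemma rat_scale: "m \<noteq> 0 \<Longrightarrow> rat (scale m v) = rat v"
  by (simp add: rat_def ratio_def scale_def)

lemma rat_scale_0: "rat (scale 0 v) = None"
  by (simp add: rat_def ratio_def scale_def)

lemma hc_nonzero: "hc p \<noteq> (0, 0)"
  by (cases p) auto

lemma rat_SomeE:
  assumes "rat v = Some p"
  obtains m where "m \<noteq> 0" "v = scale m (hc p)"
proof (cases "snd v = 0")
  case True
  then have "fst v \<noteq> 0" "p = Infty"
    using assms by (auto simp: rat_def ratio_def split: if_splits)
  then show thesis
    using True by (intro that[of "fst v"]) (auto simp: scale_def prod_eq_iff)
next
  case False
  then have "p = Fin (fst v / snd v)"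
    using assms by (auto simp: rat_def ratio_def)
  then show thesis
    using False by (intro that[of "snd v"]) (auto simp: scale_def prod_eq_iff)
qed

lemma cross_hc: "cross (hc p) (hc q) = 0 \<longleftrightarrow> p = q"
  by (cases p; cases q) (auto simp: cross_def)

lemma cross_scale: "cross (scale a v) (scale b w) = a * b * cross v w"
  by (simp add: cross_def scale_def algebra_simps)

lemma cross_scale_left: "cross (scale a v) w = a * cross v w"
  by (simp add: cross_def scale_def algebra_simps)

lemma cross_scale_right: "cross v (scale b w) = b * cross v w"
  by (simp add: cross_def scale_def algebra_simps)

lemma rat_eqI_cross:
  assumes "cross v w = 0" "rat v \<noteq> None" "rat w \<noteq> None"
  shows "rat v = rat w"
proof -
  obtain p q where pq: "rat v = Some p" "rat w = Some q"
    using assms by auto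
  obtain m n where "m \<noteq> 0" "v = scale m (hc p)" "n \<noteq> 0" "w = scale n (hc q)"
    using pq by (metis rat_SomeE)
  then have "p = q"
    using assms(1) by (simp add: cross_scale cross_hc)
  then show ?thesis
    using pq by simp
qed


section \<open>The maps in homogeneous coordinates\<close>

fun phi_hom :: "complex \<Rightarrow> complex \<Rightarrow> complex \<Rightarrow> complex \<times> complex \<Rightarrow> complex \<times> complex
    \<Rightarrow> complex \<times> complex" where
  "phi_hom \<delta> g k (x1, x0) (y1, y0) =
     (k * y0 * (x1\<^sup>2 + \<delta>\<^sup>2 * (g\<^sup>2 - k\<^sup>2) * x0\<^sup>2) - x0 * x1 * y1 * g,
      x0 * (x1 * y0 * g - x0 * y1 * k))"

fun s_hom :: "complex \<Rightarrow> complex \<Rightarrow> complex \<Rightarrow> complex \<times> complex \<Rightarrow> complex \<times> complex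
    \<Rightarrow> complex \<times> complex" where
  "s_hom \<delta> g k (x1, x0) (y1, y0) =
     (x1\<^sup>2 * y0\<^sup>2 + x0\<^sup>2 * y1\<^sup>2 - \<delta>\<^sup>2 * (g\<^sup>2 + k\<^sup>2) * x0\<^sup>2 * y0\<^sup>2,
      \<delta>\<^sup>2 * (x1 * y0 * k - x0 * y1 * g) * (x0 * y1 * k - x1 * y0 * g))"

fun t_hom :: "complex \<Rightarrow> complex \<Rightarrow> complex \<Rightarrow> complex \<times> complex \<Rightarrow> complex \<times> complex
    \<Rightarrow> complex \<times> complex" where
  "t_hom \<delta> g k (x1, x0) (y1, y0) = (x0 * (y1 - \<delta> * g * y0), y0 * (x1 - \<delta> * k * x0))"

text \<open>The formula for \<open>s_next\<close> with the factor 4 removed, by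
  \<open>cosh (2 * \<gamma>) - cosh (2 * z) = 2 * (g^2 - k^2)\<close>.\<close>

fun S_hom :: "complex \<Rightarrow> complex \<Rightarrow> complex \<Rightarrow> complex \<times> complex \<Rightarrow> complex \<times> complex" where
  "S_hom \<delta> g k (s1, s0) =
     (4 * k * g * s0 - \<delta>\<^sup>2 * (g\<^sup>2 - k\<^sup>2)\<^sup>2 * s1,
      \<delta>\<^sup>2 * (g\<^sup>2 - k\<^sup>2)\<^sup>2 * (s1 * \<delta>\<^sup>2 * k * g + s0))"

text \<open>The coefficients of \<open>t_next\<close> halved; the two coefficients of
  \<open>t1\<close> are opposite.\<close>

fun T_hom :: "complex \<Rightarrow> complex \<Rightarrow> complex \<Rightarrow> complex \<times> complex \<Rightarrow> complex \<times> complex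
    \<Rightarrow> complex \<times> complex" where
  "T_hom \<delta> g k (s1, s0) (t1, t0) =
     (((k + g) * s0 - s1 * \<delta>\<^sup>2 * g\<^sup>2 * (g - k)) * t0 + (g - k) * (s1 * \<delta>\<^sup>2 * k * g + s0) * t1,
      ((k + g) * s0 + s1 * \<delta>\<^sup>2 * k\<^sup>2 * (g - k)) * t0 - (g - k) * (s1 * \<delta>\<^sup>2 * k * g + s0) * t1)"

lemma sinh_add_diff_sum: "sinh (\<gamma> - z) + sinh (\<gamma> + z) = 2 * cosh z * sinh (\<gamma> :: complex)"
  by (simp add: sinh_add sinh_diff)

lemma sinh_add_diff_prod:
  "sinh (\<gamma> - z) * sinh (\<gamma> + z) = (sinh \<gamma>)\<^sup>2 - (sinh (z :: complex))\<^sup>2"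
proof -
  have "(cosh \<gamma>)\<^sup>2 = (sinh \<gamma>)\<^sup>2 + 1" "(cosh z)\<^sup>2 = (sinh z)\<^sup>2 + 1"
    by (simp_all add: cosh_square_eq)
  then show ?thesis
    unfolding sinh_add sinh_diff by algebra
qed

lemma cosh_double_sinh: "cosh (2 * z) = 1 + 2 * (sinh (z :: complex))\<^sup>2"
  by (simp add: cosh_double cosh_square_eq)

text \<open>The factor \<open>2 * cosh z\<close> stays inside \<open>scale\<close>, so the case
  \<open>cosh z = 0\<close>, where both sides are \<open>None\<close>, is covered.\<close>

lemma phi_eq:
  "phi \<delta> \<gamma> z (x, y) = map_option (\<lambda>xb. (xb, x))
     (rat (scale (2 * cosh z) (phi_hom \<delta> (sinh \<gamma>) (sinh z) (hc x) (hc y))))"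
proof -
  obtain x1 x0 y1 y0 where h: "hc x = (x1, x0)" "hc y = (y1, y0)"
    by (metis surj_pair)
  have p: "\<delta>\<^sup>2 * sinh (\<gamma> - z) * sinh (\<gamma> + z) = \<delta>\<^sup>2 * ((sinh \<gamma>)\<^sup>2 - (sinh z)\<^sup>2)"
    by (simp add: sinh_add_diff_prod mult.assoc)
  show ?thesis
    unfolding phi_def h split Let_def p sinh_add_diff_sum sinh_double rat_def scale_def
      phi_hom.simps fst_conv snd_conv
    by (simp add: algebra_simps)
qed

lemma s_fun_eq: "s_fun \<delta> \<gamma> z (x, y) = rat (s_hom \<delta> (sinh \<gamma>) (sinh z) (hc x) (hc y))"
  by (cases "hc x"; cases "hc y") (simp add: s_fun_def rat_def)

lemma t_fun_eq: "t_fun \<delta> \<gamma> z (x, y) = rat (t_hom \<delta> (sinh \<gamma>) (sinh z) (hc x) (hc y))"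
  by (cases "hc x"; cases "hc y") (simp add: t_fun_def rat_def)

lemma s_next_eq: "s_next \<delta> \<gamma> z s = rat (S_hom \<delta> (sinh \<gamma>) (sinh z) (hc s))"
proof -
  obtain s1 s0 where h: "hc s = (s1, s0)"
    by (metis surj_pair)
  have "s_next \<delta> \<gamma> z s = rat (scale 4 (S_hom \<delta> (sinh \<gamma>) (sinh z) (hc s)))"
    unfolding s_next_def h split Let_def rat_def scale_def S_hom.simps fst_conv snd_conv
      cosh_double_sinh
    by (simp add: algebra_simps power2_eq_square)
  then show ?thesis
    by (simp add: rat_scale)
qed

lemma t_next_eq:
  "t_next \<delta> \<gamma> z s t = rat (T_hom \<delta> (sinh \<gamma>) (sinh z) (hc s) (hc t))"
proof -
  obtain s1 s0 t1 t0 where h: "hc s = (s1, s0)" "hc t = (t1, t0)"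
    by (metis surj_pair)
  have "t_next \<delta> \<gamma> z s t = rat (scale 2 (T_hom \<delta> (sinh \<gamma>) (sinh z) (hc s) (hc t)))"
    unfolding t_next_def h split Let_def rat_def scale_def T_hom.simps fst_conv snd_conv
      cosh_double_sinh
    by (simp add: algebra_simps power2_eq_square power3_eq_cube)
  then show ?thesis
    by (simp add: rat_scale)
qed

text \<open>With \<open>(N, D)\<close> the value of \<open>s_hom\<close>, the pencil equation reads
  \<open>c1 * D - c2 * N = 0\<close>. So \<open>s\<close> is the parameter of the member through a
  point, and the base points, where \<open>N = D = 0\<close>, lie on every member.\<close>

lemma pencil_curve_iff:
  "(x, y) \<in> pencil_curve \<delta> \<gamma> z c \<longleftrightarrow>
     cross (hc c) (s_hom \<delta> (sinh \<gamma>) (sinh z) (hc x) (hc y)) = 0"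
proof -
  obtain x1 x0 y1 y0 c1 c2 where h: "hc x = (x1, x0)" "hc y = (y1, y0)" "hc c = (c1, c2)"
    by (metis surj_pair)
  show ?thesis
    unfolding pencil_curve_def h mem_Collect_eq split Let_def cross_def s_hom.simps fst_conv snd_conv
    by (rule arg_cong[of _ _ "\<lambda>u. u = 0"]) algebra
qed

section \<open>Homogeneity and the evaluation of composite maps\<close>

lemma s_hom_scale_left: "s_hom \<delta> g k (scale a X) Y = scale (a\<^sup>2) (s_hom \<delta> g k X Y)"
  by (cases X; cases Y) (simp add: scale_def algebra_simps power2_eq_square)

lemma t_hom_scale_left: "t_hom \<delta> g k (scale a X) Y = scale a (t_hom \<delta> g k X Y)"
  by (cases X; cases Y) (simp add: scale_def algebra_simps)

lemma S_hom_scale: "S_hom \<delta> g k (scale a v) = scale a (S_hom \<delta> g k v)"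
  by (cases v) (simp add: scale_def algebra_simps)

lemma T_hom_scale: "T_hom \<delta> g k (scale a v) (scale b w) = scale (a * b) (T_hom \<delta> g k v w)"
  by (cases v; cases w) (simp add: scale_def algebra_simps)

lemma phi_SomeE:
  assumes "phi \<delta> \<gamma> z (x, y) = Some q"
  obtains m xb where "m \<noteq> 0" "q = (xb, x)" "cosh z \<noteq> 0"
    "phi_hom \<delta> (sinh \<gamma>) (sinh z) (hc x) (hc y) = scale m (hc xb)"
proof -
  have c: "cosh z \<noteq> 0"
    using assms by (auto simp: phi_eq rat_scale_0)
  with assms obtain xb where "q = (xb, x)"
      "rat (phi_hom \<delta> (sinh \<gamma>) (sinh z) (hc x) (hc y)) = Some xb"
    by (auto simp: phi_eq rat_scale)
  then show thesis
    using c by (metis that rat_SomeE)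
qed

text \<open>\<open>phi_hom\<close> gives the image up to a nonzero factor, and \<open>s_hom\<close>
  is homogeneous of degree 2 in its first argument, so the composite can be computed without
  normalising the image.\<close>

lemma s_fun_phi:
  assumes "phi \<delta> \<gamma> z (x, y) \<noteq> None"
  shows "Option.bind (phi \<delta> \<gamma> z (x, y)) (s_fun \<delta> \<gamma> z) =
    rat (s_hom \<delta> (sinh \<gamma>) (sinh z) (phi_hom \<delta> (sinh \<gamma>) (sinh z) (hc x) (hc y)) (hc x))"
proof -
  obtain q where q: "phi \<delta> \<gamma> z (x, y) = Some q"
    using assms by auto
  show ?thesis
    by (rule phi_SomeE[OF q]) (simp add: q s_fun_eq s_hom_scale_left rat_scale)
qed

lemma t_fun_phi:
  assumes "phi \<delta> \<gamma> z (x, y) \<noteq> None"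
  shows "Option.bind (phi \<delta> \<gamma> z (x, y)) (t_fun \<delta> \<gamma> z) =
    rat (t_hom \<delta> (sinh \<gamma>) (sinh z) (phi_hom \<delta> (sinh \<gamma>) (sinh z) (hc x) (hc y)) (hc x))"
proof -
  obtain q where q: "phi \<delta> \<gamma> z (x, y) = Some q"
    using assms by auto
  show ?thesis
    by (rule phi_SomeE[OF q]) (simp add: q t_fun_eq t_hom_scale_left rat_scale)
qed

lemma s_next_s_fun:
  assumes "s_fun \<delta> \<gamma> z (x, y) \<noteq> None"
  shows "Option.bind (s_fun \<delta> \<gamma> z (x, y)) (s_next \<delta> \<gamma> z) =
    rat (S_hom \<delta> (sinh \<gamma>) (sinh z) (s_hom \<delta> (sinh \<gamma>) (sinh z) (hc x) (hc y)))"
proof -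
  obtain \<sigma> where \<sigma>: "s_fun \<delta> \<gamma> z (x, y) = Some \<sigma>"
    using assms by auto
  then obtain m where "m \<noteq> 0" "s_hom \<delta> (sinh \<gamma>) (sinh z) (hc x) (hc y) = scale m (hc \<sigma>)"
    unfolding s_fun_eq by (elim rat_SomeE)
  then show ?thesis
    using \<sigma> by (simp add: s_next_eq S_hom_scale rat_scale)
qed

lemma t_next_s_fun_t_fun:
  assumes "s_fun \<delta> \<gamma> z (x, y) \<noteq> None" "t_fun \<delta> \<gamma> z (x, y) \<noteq> None"
  shows "Option.bind (s_fun \<delta> \<gamma> z (x, y)) (\<lambda>\<sigma>. Option.bind (t_fun \<delta> \<gamma> z (x, y)) (t_next \<delta> \<gamma> z \<sigma>)) =
    rat (T_hom \<delta> (sinh \<gamma>) (sinh z) (s_hom \<delta> (sinh \<gamma>) (sinh z) (hc x) (hc y))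
      (t_hom \<delta> (sinh \<gamma>) (sinh z) (hc x) (hc y)))"
proof -
  obtain \<sigma> \<tau> where \<sigma>: "s_fun \<delta> \<gamma> z (x, y) = Some \<sigma>" and \<tau>: "t_fun \<delta> \<gamma> z (x, y) = Some \<tau>"
    using assms by auto
  obtain m where "m \<noteq> 0" "s_hom \<delta> (sinh \<gamma>) (sinh z) (hc x) (hc y) = scale m (hc \<sigma>)"
    using \<sigma> unfolding s_fun_eq by (elim rat_SomeE)
  moreover obtain n where "n \<noteq> 0" "t_hom \<delta> (sinh \<gamma>) (sinh z) (hc x) (hc y) = scale n (hc \<tau>)"
    using \<tau> unfolding t_fun_eq by (elim rat_SomeE)
  ultimately show ?thesis
    using \<sigma> \<tau> by (simp add: t_next_eq T_hom_scale rat_scale)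
qed


section \<open>The evolution of \<open>s\<close> and \<open>t\<close>\<close>

text \<open>The denominator of \<open>s\<close> at the image is a product of two forms, each of
  which splits off \<open>g^2 - k^2\<close>. The factorization serves the case
  \<open>g^2 = k^2\<close> and the generic definedness of \<open>s\<close> after
  \<open>phi\<close>.\<close>

lemma snd_s_hom_phi_hom:
  "snd (s_hom \<delta> g k (phi_hom \<delta> g k (x1, x0) (y1, y0)) (x1, x0)) =
     \<delta>\<^sup>2 * (g\<^sup>2 - k\<^sup>2)\<^sup>2 * x0 ^ 3 * y0 * (k\<^sup>2 * \<delta>\<^sup>2 * x0\<^sup>2 - x1\<^sup>2) * (x1 * y1 - g * k * \<delta>\<^sup>2 * x0 * y0)"
proof -
  define N where "N = fst (phi_hom \<delta> g k (x1, x0) (y1, y0))"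
  define M where "M = snd (phi_hom \<delta> g k (x1, x0) (y1, y0))"
  have NM: "phi_hom \<delta> g k (x1, x0) (y1, y0) = (N, M)"
    by (simp add: N_def M_def)
  have 1: "k * x0 * N - g * x1 * M = x0 * y0 * (g\<^sup>2 - k\<^sup>2) * (k\<^sup>2 * \<delta>\<^sup>2 * x0\<^sup>2 - x1\<^sup>2)"
    unfolding N_def M_def phi_hom.simps fst_conv snd_conv by algebra
  have 2: "k * x1 * M - g * x0 * N = x0\<^sup>2 * (g\<^sup>2 - k\<^sup>2) * (x1 * y1 - g * k * \<delta>\<^sup>2 * x0 * y0)"
    unfolding N_def M_def phi_hom.simps fst_conv snd_conv by algebra
  have 3: "snd (s_hom \<delta> g k (N, M) (x1, x0)) =
      \<delta>\<^sup>2 * (k * x0 * N - g * x1 * M) * (k * x1 * M - g * x0 * N)"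
    unfolding s_hom.simps snd_conv by algebra
  show ?thesis
    unfolding NM 3 1 2 by algebra
qed

text \<open>This form cuts out the pencil member with parameter
  \<open>(1, - (\<delta>^2 * k * g))\<close>, which is reducible: the lines at infinity in
  \<open>x\<close> and \<open>y\<close> and the hyperbola \<open>x * y = g * k * \<delta>^2\<close>.
  If \<open>g^2 + k^2 = 0\<close>, the form is zero and the two generators are dependent.\<close>

lemma s_hom_singular_combination:
  "fst (s_hom \<delta> g k (x1, x0) (y1, y0)) * \<delta>\<^sup>2 * k * g + snd (s_hom \<delta> g k (x1, x0) (y1, y0)) =
     \<delta>\<^sup>2 * (g\<^sup>2 + k\<^sup>2) * x0 * y0 * (x1 * y1 - g * k * \<delta>\<^sup>2 * x0 * y0)"
  unfolding s_hom.simps fst_conv snd_conv by algebra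

lemma s_hom_phi_hom:
  "scale (\<delta>\<^sup>2 * (g\<^sup>2 + k\<^sup>2)) (s_hom \<delta> g k (phi_hom \<delta> g k (x1, x0) (y1, y0)) (x1, x0)) =
     scale (x0\<^sup>2 * (k\<^sup>2 * \<delta>\<^sup>2 * x0\<^sup>2 - x1\<^sup>2)) (S_hom \<delta> g k (s_hom \<delta> g k (x1, x0) (y1, y0)))"
    (is "scale ?a ?v = scale ?b ?w")
proof (rule prod_eqI)
  show "fst (scale ?a ?v) = fst (scale ?b ?w)"
    unfolding scale_def s_hom.simps phi_hom.simps S_hom.simps fst_conv snd_conv by algebra
  obtain N D where ND: "s_hom \<delta> g k (x1, x0) (y1, y0) = (N, D)"
    by (metis surj_pair)
  \<comment> \<open>The Riccati denominator is a multiple of the singular combination, so both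
    second coordinates are available as products and need no expansion.\<close>
  have w: "snd ?w = \<delta>\<^sup>2 * (g\<^sup>2 - k\<^sup>2)\<^sup>2 *
      (\<delta>\<^sup>2 * (g\<^sup>2 + k\<^sup>2) * x0 * y0 * (x1 * y1 - g * k * \<delta>\<^sup>2 * x0 * y0))"
    using s_hom_singular_combination[of \<delta> g k x1 x0 y1 y0]
    unfolding ND S_hom.simps fst_conv snd_conv by simp
  show "snd (scale ?a ?v) = snd (scale ?b ?w)"
    unfolding scale_def snd_conv snd_s_hom_phi_hom w by algebra
qed

text \<open>Not a consequence of the previous identity alone when \<open>\<delta>\<^sup>2 (g\<^sup>2 + k\<^sup>2) = 0\<close>.\<close>

lemma cross_s_hom_phi_hom:
  "cross (s_hom \<delta> g k (phi_hom \<delta> g k X Y) X) (S_hom \<delta> g k (s_hom \<delta> g k X Y)) = 0"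
proof -
  obtain x1 x0 y1 y0 where XY: "X = (x1, x0)" "Y = (y1, y0)"
    by (metis surj_pair)
  let ?v = "s_hom \<delta> g k (phi_hom \<delta> g k X Y) X" and ?w = "S_hom \<delta> g k (s_hom \<delta> g k X Y)"
  \<comment> \<open>\<open>?E\<close> is common to both second coordinates: with
    \<open>A = \<delta>^2 * (g^2 + k^2)\<close> and
    \<open>B = x0^2 * (k^2 * \<delta>^2 * x0^2 - x1^2)\<close> they are
    \<open>\<delta>^2 * A * ?E\<close> and \<open>\<delta>^2 * B * ?E\<close>. The determinant is
    then \<open>\<delta>^2 * ?E * (A * fst ?v - B * fst ?w)\<close>, which is zero without dividing
    by \<open>A\<close>.\<close>
  let ?E = "(g\<^sup>2 - k\<^sup>2)\<^sup>2 * x0 * y0 * (x1 * y1 - g * k * \<delta>\<^sup>2 * x0 * y0)"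
  obtain N D where ND: "s_hom \<delta> g k X Y = (N, D)"
    by (metis surj_pair)
  have "snd ?w = \<delta>\<^sup>2 * (\<delta>\<^sup>2 * (g\<^sup>2 + k\<^sup>2)) * ?E"
    using s_hom_singular_combination[of \<delta> g k x1 x0 y1 y0] ND
    unfolding XY by simp
  moreover have "snd ?v = \<delta>\<^sup>2 * (x0\<^sup>2 * (k\<^sup>2 * \<delta>\<^sup>2 * x0\<^sup>2 - x1\<^sup>2)) * ?E"
    unfolding XY snd_s_hom_phi_hom by (simp add: power2_eq_square power3_eq_cube)
  moreover have "\<delta>\<^sup>2 * (g\<^sup>2 + k\<^sup>2) * fst ?v = x0\<^sup>2 * (k\<^sup>2 * \<delta>\<^sup>2 * x0\<^sup>2 - x1\<^sup>2) * fst ?w"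
    using s_hom_phi_hom[of \<delta> g k x1 x0 y1 y0] unfolding XY scale_def by simp
  ultimately show ?thesis
    unfolding cross_def by algebra
qed

lemma cross_t_hom_phi_hom:
  "cross (t_hom \<delta> g k (phi_hom \<delta> g k X Y) X) (T_hom \<delta> g k (s_hom \<delta> g k X Y) (t_hom \<delta> g k X Y)) = 0"
proof -
  obtain x1 x0 y1 y0 where XY: "X = (x1, x0)" "Y = (y1, y0)"
    by (metis surj_pair)
  show ?thesis
    unfolding XY cross_def s_hom.simps phi_hom.simps t_hom.simps T_hom.simps fst_conv snd_conv
    by algebra
qed

lemma agree_s:
  "agree (\<lambda>p. Option.bind (phi \<delta> \<gamma> z p) (s_fun \<delta> \<gamma> z))
     (\<lambda>p. Option.bind (s_fun \<delta> \<gamma> z p) (s_next \<delta> \<gamma> z))"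
  unfolding agree_def
proof (intro allI impI)
  fix p :: "P1 \<times> P1"
  obtain x y where p: "p = (x, y)"
    by (metis surj_pair)
  assume a: "Option.bind (phi \<delta> \<gamma> z p) (s_fun \<delta> \<gamma> z) \<noteq> None"
    and b: "Option.bind (s_fun \<delta> \<gamma> z p) (s_next \<delta> \<gamma> z) \<noteq> None"
  then have 1: "phi \<delta> \<gamma> z (x, y) \<noteq> None" and 2: "s_fun \<delta> \<gamma> z (x, y) \<noteq> None"
    unfolding p by (metis bind.bind_lzero)+
  show "Option.bind (phi \<delta> \<gamma> z p) (s_fun \<delta> \<gamma> z) = Option.bind (s_fun \<delta> \<gamma> z p) (s_next \<delta> \<gamma> z)"
    using a b unfolding p s_fun_phi[OF 1] s_next_s_fun[OF 2]
    by (rule rat_eqI_cross[OF cross_s_hom_phi_hom])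
qed

lemma agree_t:
  "agree (\<lambda>p. Option.bind (phi \<delta> \<gamma> z p) (t_fun \<delta> \<gamma> z))
     (\<lambda>p. Option.bind (s_fun \<delta> \<gamma> z p)
        (\<lambda>\<sigma>. Option.bind (t_fun \<delta> \<gamma> z p) (t_next \<delta> \<gamma> z \<sigma>)))" (is "agree ?f ?h")
  unfolding agree_def
proof (intro allI impI)
  fix p :: "P1 \<times> P1"
  obtain x y where p: "p = (x, y)"
    by (metis surj_pair)
  assume a: "?f p \<noteq> None" and b: "?h p \<noteq> None"
  then have 1: "phi \<delta> \<gamma> z (x, y) \<noteq> None" and 2: "s_fun \<delta> \<gamma> z (x, y) \<noteq> None"
      and 3: "t_fun \<delta> \<gamma> z (x, y) \<noteq> None"
    unfolding p by (auto simp: bind_eq_None_conv)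
  show "?f p = ?h p"
    using a b unfolding p t_fun_phi[OF 1] t_next_s_fun_t_fun[OF 2 3]
    by (rule rat_eqI_cross[OF cross_t_hom_phi_hom])
qed


section \<open>The action on the pencil\<close>

text \<open>Where \<open>s\<close> is determinate, \<open>s_hom\<close> is a nonzero multiple of
  \<open>hc \<sigma>\<close>, and membership says that \<open>hc c\<close> is proportional to
  it.\<close>

lemma pencil_curve_s_fun:
  assumes "s_fun \<delta> \<gamma> z p = Some \<sigma>"
  shows "p \<in> pencil_curve \<delta> \<gamma> z c \<longleftrightarrow> c = \<sigma>"
proof -
  obtain x y where p: "p = (x, y)"
    by (metis surj_pair)
  obtain m where "m \<noteq> 0" "s_hom \<delta> (sinh \<gamma>) (sinh z) (hc x) (hc y) = scale m (hc \<sigma>)"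
    using assms unfolding p s_fun_eq by (elim rat_SomeE)
  then show ?thesis
    by (simp add: p pencil_curve_iff cross_scale_right cross_hc)
qed

lemma phi_in_pencil_curve_iff:
  assumes "phi \<delta> \<gamma> z (x, y) = Some q"
  shows "q \<in> pencil_curve \<delta> \<gamma> z c \<longleftrightarrow> cross (hc c)
    (s_hom \<delta> (sinh \<gamma>) (sinh z) (phi_hom \<delta> (sinh \<gamma>) (sinh z) (hc x) (hc y)) (hc x)) = 0"
  using assms
  by (elim phi_SomeE) (simp add: pencil_curve_iff s_hom_scale_left cross_scale_right)

text \<open>Cayley-Hamilton for a traceless matrix: the square is minus the determinant.\<close>

lemma S_hom_S_hom:
  "S_hom \<delta> g k (S_hom \<delta> g k v) = scale ((\<delta>\<^sup>2 * (g\<^sup>2 - k\<^sup>2) * (g\<^sup>2 + k\<^sup>2))\<^sup>2) v"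
proof (rule prod_eqI)
  obtain s1 s0 where v: "v = (s1, s0)"
    by (metis surj_pair)
  show "fst (S_hom \<delta> g k (S_hom \<delta> g k v)) =
      fst (scale ((\<delta>\<^sup>2 * (g\<^sup>2 - k\<^sup>2) * (g\<^sup>2 + k\<^sup>2))\<^sup>2) v)"
    unfolding v scale_def S_hom.simps fst_conv snd_conv by algebra
  show "snd (S_hom \<delta> g k (S_hom \<delta> g k v)) =
      snd (scale ((\<delta>\<^sup>2 * (g\<^sup>2 - k\<^sup>2) * (g\<^sup>2 + k\<^sup>2))\<^sup>2) v)"
    unfolding v scale_def S_hom.simps fst_conv snd_conv by algebra
qed

text \<open>The constant is the determinant of the matrix of \<open>S_hom\<close>.\<close>

lemma cross_S_hom:
  "cross (S_hom \<delta> g k v) (S_hom \<delta> g k w) =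
     - ((\<delta>\<^sup>2 * (g\<^sup>2 - k\<^sup>2) * (g\<^sup>2 + k\<^sup>2))\<^sup>2) * cross v w"
proof -
  obtain v1 v0 w1 w0 where vw: "v = (v1, v0)" "w = (w1, w0)"
    by (metis surj_pair)
  show ?thesis
    unfolding vw cross_def S_hom.simps fst_conv snd_conv by algebra
qed

lemma S_hom_nonzero:
  assumes "\<delta> \<noteq> 0" "g\<^sup>2 \<noteq> k\<^sup>2" "g\<^sup>2 + k\<^sup>2 \<noteq> 0" "v \<noteq> (0, 0)"
  shows "S_hom \<delta> g k v \<noteq> (0, 0)"
proof
  assume "S_hom \<delta> g k v = (0, 0)"
  then have "scale ((\<delta>\<^sup>2 * (g\<^sup>2 - k\<^sup>2) * (g\<^sup>2 + k\<^sup>2))\<^sup>2) v = (0, 0)"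
    unfolding S_hom_S_hom[symmetric] by simp
  then show False
    using assms by (auto simp: scale_def prod_eq_iff)
qed

text \<open>\<open>S_hom\<close> kills no nonzero vector here, so it induces a total map of the
  parameter line; its square is scalar, so this map is an involution and hence bijective.\<close>

lemma bij_acts_on_pencil:
  assumes "\<delta> \<noteq> 0" and g: "(sinh \<gamma>)\<^sup>2 \<noteq> (sinh z)\<^sup>2" "(sinh \<gamma>)\<^sup>2 + (sinh z)\<^sup>2 \<noteq> 0"
  shows "\<exists>\<tau>. acts_on_pencil (phi \<delta> \<gamma> z) (pencil_curve \<delta> \<gamma> z) \<tau> \<and> bij \<tau>"
proof -
  let ?g = "sinh \<gamma>" and ?k = "sinh z"
  define \<tau> where "\<tau> c = the (rat (S_hom \<delta> ?g ?k (hc c)))" for c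
  have \<tau>: "rat (S_hom \<delta> ?g ?k (hc c)) = Some (\<tau> c)" for c
    using S_hom_nonzero[OF assms hc_nonzero[of c]]
    by (auto simp: \<tau>_def rat_eq_None_iff[symmetric])
  have "\<tau> (\<tau> c) = c" for c
  proof -
    obtain m where m: "m \<noteq> 0" "S_hom \<delta> ?g ?k (hc c) = scale m (hc (\<tau> c))"
      using \<tau> by (rule rat_SomeE)
    have "Some (\<tau> (\<tau> c)) = rat (S_hom \<delta> ?g ?k (S_hom \<delta> ?g ?k (hc c)))"
      using \<tau>[of "\<tau> c"] m by (simp add: S_hom_scale rat_scale)
    also have "\<dots> = rat (hc c)"
      unfolding S_hom_S_hom using assms by (intro rat_scale) auto
    also have "\<dots> = Some c"
      by (cases c) (auto simp: rat_def ratio_def)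
    finally show ?thesis by simp
  qed
  then have "bij \<tau>"
    by (intro o_bij[of \<tau>]) auto
  moreover have "acts_on_pencil (phi \<delta> \<gamma> z) (pencil_curve \<delta> \<gamma> z) \<tau>"
    unfolding acts_on_pencil_def
  proof (intro allI ballI impI)
    fix c p q
    assume p: "p \<in> pencil_curve \<delta> \<gamma> z c" and q: "phi \<delta> \<gamma> z p = Some q"
    obtain x y where xy: "p = (x, y)"
      by (metis surj_pair)
    obtain x1 x0 y1 y0 where h: "hc x = (x1, x0)" "hc y = (y1, y0)"
      by (metis surj_pair)
    obtain m where m: "m \<noteq> 0" "S_hom \<delta> ?g ?k (hc c) = scale m (hc (\<tau> c))"
      using \<tau> by (rule rat_SomeE)
    let ?v = "s_hom \<delta> ?g ?k (phi_hom \<delta> ?g ?k (hc x) (hc y)) (hc x)"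
    \<comment> \<open>Membership is multiplied by nonzero constants so that
      \<open>s_hom_phi_hom\<close> applies; the determinant rule then leads back to the equation for
      \<open>p\<close>. Since \<open>s\<close> is never evaluated, base points are included.\<close>
    have "\<delta>\<^sup>2 * (?g\<^sup>2 + ?k\<^sup>2) * m * cross (hc (\<tau> c)) ?v =
        cross (S_hom \<delta> ?g ?k (hc c)) (scale (\<delta>\<^sup>2 * (?g\<^sup>2 + ?k\<^sup>2)) ?v)"
      by (simp add: m cross_scale)
    also have "\<dots> = 0"
      using p unfolding xy pencil_curve_iff h s_hom_phi_hom cross_scale_right cross_S_hom by simp
    finally have "cross (hc (\<tau> c)) ?v = 0"
      using assms m by simp
    then show "q \<in> pencil_curve \<delta> \<gamma> z (\<tau> c)"
      using q phi_in_pencil_curve_iff unfolding xy by blast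
  qed
  ultimately show ?thesis by blast
qed

text \<open>The hypothesis puts every image on the member with parameter \<open>v\<close>, so a
  constant action on parameters works.\<close>

lemma acts_on_pencil_const:
  assumes "\<And>x1 x0 y1 y0. cross v (s_hom \<delta> (sinh \<gamma>) (sinh z)
      (phi_hom \<delta> (sinh \<gamma>) (sinh z) (x1, x0) (y1, y0)) (x1, x0)) = 0"
    and "v \<noteq> (0, 0)"
  shows "\<exists>\<tau>. acts_on_pencil (phi \<delta> \<gamma> z) (pencil_curve \<delta> \<gamma> z) \<tau>"
proof -
  obtain c where "rat v = Some c"
    using assms(2) rat_eq_None_iff by blast
  then obtain m where m: "m \<noteq> 0" "v = scale m (hc c)"
    by (rule rat_SomeE)
  have "acts_on_pencil (phi \<delta> \<gamma> z) (pencil_curve \<delta> \<gamma> z) (\<lambda>_. c)"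
    unfolding acts_on_pencil_def
  proof (intro allI ballI impI)
    fix p q
    assume q: "phi \<delta> \<gamma> z p = Some q"
    obtain x y where xy: "p = (x, y)"
      by (metis surj_pair)
    have "cross (hc c) (s_hom \<delta> (sinh \<gamma>) (sinh z)
        (phi_hom \<delta> (sinh \<gamma>) (sinh z) (hc x) (hc y)) (hc x)) = 0"
      using assms(1)[of "fst (hc x)" "snd (hc x)" "fst (hc y)" "snd (hc y)"] m
      by (simp add: cross_scale_left)
    then show "q \<in> pencil_curve \<delta> \<gamma> z c"
      using q phi_in_pencil_curve_iff unfolding xy by blast
  qed
  then show ?thesis by blast
qed

lemma ex_acts_on_pencil:
  assumes "\<delta> \<noteq> 0"
  shows "\<exists>\<tau>. acts_on_pencil (phi \<delta> \<gamma> z) (pencil_curve \<delta> \<gamma> z) \<tau> \<and> (nondegenerate \<gamma> z \<longrightarrow> bij \<tau>)"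
proof -
  consider "(sinh \<gamma>)\<^sup>2 = (sinh z)\<^sup>2" | "(sinh \<gamma>)\<^sup>2 + (sinh z)\<^sup>2 = 0"
    | "(sinh \<gamma>)\<^sup>2 \<noteq> (sinh z)\<^sup>2" "(sinh \<gamma>)\<^sup>2 + (sinh z)\<^sup>2 \<noteq> 0"
    by blast
  then show ?thesis
  proof cases
    case 1
    have "\<exists>\<tau>. acts_on_pencil (phi \<delta> \<gamma> z) (pencil_curve \<delta> \<gamma> z) \<tau>"
    \<comment> \<open>The determinant with \<open>(1, 0)\<close> is the second coordinate, which has
      the factor \<open>(g^2 - k^2)^2\<close>.\<close>
    proof (rule acts_on_pencil_const[of "(1, 0)"])
      show "cross (1, 0) (s_hom \<delta> (sinh \<gamma>) (sinh z)
          (phi_hom \<delta> (sinh \<gamma>) (sinh z) (x1, x0) (y1, y0)) (x1, x0)) = 0" for x1 x0 y1 y0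
        using 1 by (simp add: cross_def snd_s_hom_phi_hom del: s_hom.simps phi_hom.simps)
    qed simp
    then show ?thesis
      using 1 by (simp add: nondegenerate_def)
  next
    case 2
    have "\<exists>\<tau>. acts_on_pencil (phi \<delta> \<gamma> z) (pencil_curve \<delta> \<gamma> z) \<tau>"
    \<comment> \<open>The determinant with this vector is the singular combination, which has the
      factor \<open>g^2 + k^2\<close>.\<close>
    proof (rule acts_on_pencil_const[of "(1, - (\<delta>\<^sup>2 * sinh z * sinh \<gamma>))"])
      fix x1 x0 y1 y0
      obtain N M where NM: "phi_hom \<delta> (sinh \<gamma>) (sinh z) (x1, x0) (y1, y0) = (N, M)"
        by (metis surj_pair)
      show "cross (1, - (\<delta>\<^sup>2 * sinh z * sinh \<gamma>)) (s_hom \<delta> (sinh \<gamma>) (sinh z)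
          (phi_hom \<delta> (sinh \<gamma>) (sinh z) (x1, x0) (y1, y0)) (x1, x0)) = 0"
        using s_hom_singular_combination[of \<delta> "sinh \<gamma>" "sinh z" N M x1 x0] 2
        unfolding NM cross_def by (simp add: algebra_simps del: s_hom.simps)
    qed simp
    then show ?thesis
      using 2 by (simp add: nondegenerate_def)
  next
    case 3
    then show ?thesis
      using bij_acts_on_pencil[OF assms] by blast
  qed
qed


section \<open>The Riccati equations\<close>

lemma s_next_frac_lin:
  "s_next \<delta> \<gamma> z = frac_lin (16 * sinh z * sinh \<gamma>) (- \<delta>\<^sup>2 * (cosh (2 * \<gamma>) - cosh (2 * z))\<^sup>2)
     (\<delta>\<^sup>2 * (cosh (2 * \<gamma>) - cosh (2 * z))\<^sup>2)
     (\<delta>\<^sup>2 * (cosh (2 * \<gamma>) - cosh (2 * z))\<^sup>2 * (\<delta>\<^sup>2 * sinh z * sinh \<gamma>))"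
  by (rule ext) (simp add: s_next_def frac_lin_def Let_def split_def algebra_simps)

lemma t_next_frac_lin:
  assumes "hc s = (s1, s0)"
  shows "t_next \<delta> \<gamma> z s =
    frac_lin ((sinh z + sinh \<gamma>) * s0 - s1 * \<delta>\<^sup>2 * (sinh \<gamma>)\<^sup>2 * (sinh \<gamma> - sinh z))
      ((sinh \<gamma> - sinh z) * (s1 * \<delta>\<^sup>2 * sinh z * sinh \<gamma> + s0))
      ((sinh z + sinh \<gamma>) * s0 + s1 * \<delta>\<^sup>2 * (sinh z)\<^sup>2 * (sinh \<gamma> - sinh z))
      (- ((sinh \<gamma> - sinh z) * (s1 * \<delta>\<^sup>2 * sinh z * sinh \<gamma> + s0)))"
proof
  fix t
  obtain t1 t0 where h: "hc t = (t1, t0)"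
    by (metis surj_pair)
  show "t_next \<delta> \<gamma> z s t =
    frac_lin ((sinh z + sinh \<gamma>) * s0 - s1 * \<delta>\<^sup>2 * (sinh \<gamma>)\<^sup>2 * (sinh \<gamma> - sinh z))
      ((sinh \<gamma> - sinh z) * (s1 * \<delta>\<^sup>2 * sinh z * sinh \<gamma> + s0))
      ((sinh z + sinh \<gamma>) * s0 + s1 * \<delta>\<^sup>2 * (sinh z)\<^sup>2 * (sinh \<gamma> - sinh z))
      (- ((sinh \<gamma> - sinh z) * (s1 * \<delta>\<^sup>2 * sinh z * sinh \<gamma> + s0))) t"
    by (simp add: t_next_eq assms h frac_lin_def rat_def)
qed

lemma riccati_cascade_next: "riccati_cascade (s_next \<delta> \<gamma> z) (t_next \<delta> \<gamma> z)"
proof -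
  have "discrete_riccati (t_next \<delta> \<gamma> z s)" for s
    using t_next_frac_lin[of s "fst (hc s)" "snd (hc s)"]
    unfolding discrete_riccati_def by (metis prod.collapse)
  then show ?thesis
    using s_next_frac_lin unfolding riccati_cascade_def discrete_riccati_def by blast
qed

lemma nondegenerate_riccati_s_next:
  assumes "\<delta> \<noteq> 0" "nondegenerate \<gamma> z"
  shows "nondegenerate_riccati (s_next \<delta> \<gamma> z)"
proof -
  let ?g = "sinh \<gamma>" and ?k = "sinh z" and ?c = "cosh (2 * \<gamma>) - cosh (2 * z)"
  have c: "?c = 2 * (?g\<^sup>2 - ?k\<^sup>2)"
    by (simp add: cosh_double_sinh)
  \<comment> \<open>The determinant of the fractional linear map is a perfect square whose factors
    are nonzero by nondegeneracy.\<close>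
  have "16 * ?k * ?g * (\<delta>\<^sup>2 * ?c\<^sup>2 * (\<delta>\<^sup>2 * ?k * ?g)) - - \<delta>\<^sup>2 * ?c\<^sup>2 * (\<delta>\<^sup>2 * ?c\<^sup>2) =
      (4 * \<delta>\<^sup>2 * (?g\<^sup>2 - ?k\<^sup>2) * (?g\<^sup>2 + ?k\<^sup>2))\<^sup>2"
    unfolding c by algebra
  moreover have "4 * \<delta>\<^sup>2 * (?g\<^sup>2 - ?k\<^sup>2) * (?g\<^sup>2 + ?k\<^sup>2) \<noteq> 0"
    using assms by (simp add: nondegenerate_def)
  ultimately have "16 * ?k * ?g * (\<delta>\<^sup>2 * ?c\<^sup>2 * (\<delta>\<^sup>2 * ?k * ?g)) \<noteq> - \<delta>\<^sup>2 * ?c\<^sup>2 * (\<delta>\<^sup>2 * ?c\<^sup>2)"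
    by (metis right_minus_eq zero_eq_power2)
  then show ?thesis
    using s_next_frac_lin unfolding nondegenerate_riccati_def by blast
qed

section \<open>Cofinite conditions and generic nondegeneracy of the equation for
  \<open>t\<close>\<close>

lemma MOST_linear_nonzero:
  fixes a b :: complex
  assumes "a \<noteq> 0 \<or> b \<noteq> 0"
  shows "MOST y. a * y + b \<noteq> 0"
proof -
  have "finite {y. a * y + b = 0}"
  proof (cases "a = 0")
    case False
    then have "{y. a * y + b = 0} \<subseteq> {- b / a}"
      by (auto simp: field_simps add_eq_0_iff)
    then show ?thesis
      using finite_subset by blast
  qed (use assms in simp)
  then show ?thesis
    by (simp add: MOST_iff_cofinite)
qed

lemma MOST_sq_diff_neq:
  fixes x r :: complex
  shows "MOST y. (x - y)\<^sup>2 \<noteq> r"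
proof -
  have "{y. (x - y)\<^sup>2 = r} \<subseteq> {x - csqrt r, x + csqrt r}"
  proof
    fix y
    assume "y \<in> {y. (x - y)\<^sup>2 = r}"
    then have "(x - y)\<^sup>2 = (csqrt r)\<^sup>2"
      by simp
    then show "y \<in> {x - csqrt r, x + csqrt r}"
      unfolding power2_eq_iff by (auto simp: algebra_simps)
  qed
  then have "finite {y. (x - y)\<^sup>2 = r}"
    using finite_subset by blast
  then show ?thesis
    by (simp add: MOST_iff_cofinite)
qed

lemma MOST_P1:
  assumes "MOST s. P (Fin s)"
  shows "MOST \<sigma>. P \<sigma>"
proof -
  have "{\<sigma>. \<not> P \<sigma>} \<subseteq> insert Infty (Fin ` {s. \<not> P (Fin s)})"
  proof
    fix \<sigma> assume "\<sigma> \<in> {\<sigma>. \<not> P \<sigma>}"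
    then show "\<sigma> \<in> insert Infty (Fin ` {s. \<not> P (Fin s)})"
      by (cases \<sigma>) auto
  qed
  then show ?thesis
    using assms by (metis MOST_iff_cofinite finite_imageI finite_insert finite_subset)
qed

text \<open>The terms in \<open>t1\<close> cancel. A nonzero sum is a convenient witness that the
  vector is not \<open>(0, 0)\<close>.\<close>

lemma T_hom_sum:
  "fst (T_hom \<delta> g k (s1, s0) (t1, t0)) + snd (T_hom \<delta> g k (s1, s0) (t1, t0)) =
     (g + k) * (2 * s0 - \<delta>\<^sup>2 * s1 * (g - k)\<^sup>2) * t0"
  unfolding T_hom.simps fst_conv snd_conv by algebra

text \<open>The coefficients have the form \<open>a, b, c, - b\<close>, so the determinant is
  \<open>- b * (a + c)\<close>. Both factors are affine in \<open>s\<close> with nonzero constant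
  term, so at most two finite values of \<open>s\<close> are exceptional.\<close>

lemma MOST_nondegenerate_riccati_t_next:
  assumes "nondegenerate \<gamma> z"
  shows "MOST \<sigma>. nondegenerate_riccati (t_next \<delta> \<gamma> z \<sigma>)"
proof (rule MOST_P1)
  let ?g = "sinh \<gamma>" and ?k = "sinh z"
  have gk: "?g - ?k \<noteq> 0" "?g + ?k \<noteq> 0"
    using assms by (auto simp: nondegenerate_def power2_eq_iff add_eq_0_iff2)
  have "MOST s. \<delta>\<^sup>2 * ?k * ?g * s + 1 \<noteq> 0" "MOST s. - (\<delta>\<^sup>2 * (?g - ?k)\<^sup>2) * s + 2 \<noteq> 0"
    by (rule MOST_linear_nonzero; simp)+
  then show "MOST s. nondegenerate_riccati (t_next \<delta> \<gamma> z (Fin s))"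
  proof (rule MOST_rev_mp[OF MOST_conjI], intro MOST_I impI)
    fix s
    assume s: "\<delta>\<^sup>2 * ?k * ?g * s + 1 \<noteq> 0 \<and> - (\<delta>\<^sup>2 * (?g - ?k)\<^sup>2) * s + 2 \<noteq> 0"
    let ?a = "(?k + ?g) * 1 - s * \<delta>\<^sup>2 * ?g\<^sup>2 * (?g - ?k)"
      and ?b = "(?g - ?k) * (s * \<delta>\<^sup>2 * ?k * ?g + 1)"
      and ?c = "(?k + ?g) * 1 + s * \<delta>\<^sup>2 * ?k\<^sup>2 * (?g - ?k)"
    have "?a * (- ?b) - ?b * ?c =
        - ((?g - ?k) * (\<delta>\<^sup>2 * ?k * ?g * s + 1) * (?g + ?k) * (- (\<delta>\<^sup>2 * (?g - ?k)\<^sup>2) * s + 2))"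
      by algebra
    moreover have "\<dots> \<noteq> 0"
      using s gk by simp
    ultimately have "?a * (- ?b) \<noteq> ?b * ?c"
      by (metis right_minus_eq)
    then show "nondegenerate_riccati (t_next \<delta> \<gamma> z (Fin s))"
      using t_next_frac_lin[of "Fin s" s 1] unfolding nondegenerate_riccati_def by fastforce
  qed
qed


section \<open>Generic definedness\<close>

text \<open>One list of exceptional curves serves all four composites. The first three conditions
  remove finitely many \<open>x\<close>; for each remaining \<open>x\<close>, the others remove
  finitely many \<open>y\<close>, where \<open>x \<noteq> 0\<close> keeps the linear forms in
  \<open>y\<close> from vanishing identically.\<close>

lemma generically_definedI:
  assumes "(g :: complex)\<^sup>2 \<noteq> k\<^sup>2"
    and "\<And>x y. \<lbrakk>x \<noteq> 0; x \<noteq> \<delta> * g; x\<^sup>2 \<noteq> k\<^sup>2 * \<delta>\<^sup>2; x * g - y * k \<noteq> 0; x * k - y * g \<noteq> 0;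
      x * y - g * k * \<delta>\<^sup>2 \<noteq> 0; (x - y)\<^sup>2 \<noteq> \<delta>\<^sup>2 * (g - k)\<^sup>2\<rbrakk> \<Longrightarrow> f (Fin x, Fin y) \<noteq> None"
  shows "generically_defined f"
proof -
  have gk: "g \<noteq> 0 \<or> k \<noteq> 0"
    using assms(1) by auto
  have inner: "MOST y. f (Fin x, Fin y) \<noteq> None"
    if x: "x \<noteq> 0" "x \<noteq> \<delta> * g" "x\<^sup>2 \<noteq> k\<^sup>2 * \<delta>\<^sup>2" for x
  proof -
    have "MOST y. - k * y + x * g \<noteq> 0" "MOST y. - g * y + x * k \<noteq> 0"
        "MOST y. x * y + - (g * k * \<delta>\<^sup>2) \<noteq> 0" "MOST y. (x - y)\<^sup>2 \<noteq> \<delta>\<^sup>2 * (g - k)\<^sup>2"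
      by (rule MOST_linear_nonzero MOST_sq_diff_neq; use gk x in auto)+
    then have "MOST y. - k * y + x * g \<noteq> 0 \<and> - g * y + x * k \<noteq> 0 \<and>
        x * y + - (g * k * \<delta>\<^sup>2) \<noteq> 0 \<and> (x - y)\<^sup>2 \<noteq> \<delta>\<^sup>2 * (g - k)\<^sup>2"
      by (intro MOST_conjI)
    then show ?thesis
    proof (rule MOST_mono)
      fix y
      assume "- k * y + x * g \<noteq> 0 \<and> - g * y + x * k \<noteq> 0 \<and>
        x * y + - (g * k * \<delta>\<^sup>2) \<noteq> 0 \<and> (x - y)\<^sup>2 \<noteq> \<delta>\<^sup>2 * (g - k)\<^sup>2"
      then show "f (Fin x, Fin y) \<noteq> None"
        using x by (intro assms(2)) (auto simp: algebra_simps)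
    qed
  qed
  have "MOST x. 1 * x + 0 \<noteq> (0 :: complex)" "MOST x. 1 * x + - (\<delta> * g) \<noteq> 0"
      "MOST x. (0 - x)\<^sup>2 \<noteq> k\<^sup>2 * \<delta>\<^sup>2"
    by (rule MOST_linear_nonzero MOST_sq_diff_neq; simp)+
  then have "MOST x. 1 * x + 0 \<noteq> (0 :: complex) \<and> 1 * x + - (\<delta> * g) \<noteq> 0 \<and> (0 - x)\<^sup>2 \<noteq> k\<^sup>2 * \<delta>\<^sup>2"
    by (intro MOST_conjI)
  then show ?thesis
    unfolding generically_defined_def
    by (rule MOST_mono) (intro inner; auto)
qed

context
  fixes \<delta> \<gamma> z :: complex
  assumes \<delta>: "\<delta> \<noteq> 0" and nd: "nondegenerate \<gamma> z"
begin

lemma phi_defined: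
  assumes "x * sinh \<gamma> - y * sinh z \<noteq> 0"
  shows "phi \<delta> \<gamma> z (Fin x, Fin y) \<noteq> None"
  using assms nd by (simp add: phi_eq rat_scale rat_eq_None_iff nondegenerate_def)

lemma s_fun_defined:
  assumes "x * sinh \<gamma> - y * sinh z \<noteq> 0" "x * sinh z - y * sinh \<gamma> \<noteq> 0"
  shows "s_fun \<delta> \<gamma> z (Fin x, Fin y) \<noteq> None"
  using assms \<delta> by (auto simp: s_fun_eq rat_eq_None_iff mult.commute)

lemma t_fun_defined:
  assumes "x \<noteq> \<delta> * sinh z"
  shows "t_fun \<delta> \<gamma> z (Fin x, Fin y) \<noteq> None"
  using assms by (simp add: t_fun_eq rat_eq_None_iff)

lemma squares_neq: "(sinh \<gamma>)\<^sup>2 \<noteq> (sinh z)\<^sup>2"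
  using nd by (simp add: nondegenerate_def)

lemma generically_defined_s_bar:
  "generically_defined (\<lambda>p. Option.bind (phi \<delta> \<gamma> z p) (s_fun \<delta> \<gamma> z))"
proof (rule generically_definedI[OF squares_neq])
  fix x y
  assume a: "x\<^sup>2 \<noteq> (sinh z)\<^sup>2 * \<delta>\<^sup>2" "x * sinh \<gamma> - y * sinh z \<noteq> 0"
    "x * y - sinh \<gamma> * sinh z * \<delta>\<^sup>2 \<noteq> 0"
  have "snd (s_hom \<delta> (sinh \<gamma>) (sinh z)
      (phi_hom \<delta> (sinh \<gamma>) (sinh z) (x, 1) (y, 1)) (x, 1)) \<noteq> 0"
    unfolding snd_s_hom_phi_hom using a \<delta> squares_neq by simp
  then show "Option.bind (phi \<delta> \<gamma> z (Fin x, Fin y)) (s_fun \<delta> \<gamma> z) \<noteq> None"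
    unfolding s_fun_phi[OF phi_defined[OF a(2)]] rat_eq_None_iff hc.simps by auto
qed

lemma generically_defined_t_bar:
  "generically_defined (\<lambda>p. Option.bind (phi \<delta> \<gamma> z p) (t_fun \<delta> \<gamma> z))"
proof (rule generically_definedI[OF squares_neq])
  fix x y
  assume a: "x \<noteq> \<delta> * sinh \<gamma>" "x * sinh \<gamma> - y * sinh z \<noteq> 0"
  then show "Option.bind (phi \<delta> \<gamma> z (Fin x, Fin y)) (t_fun \<delta> \<gamma> z) \<noteq> None"
    \<comment> \<open>The first homogeneous coordinate is \<open>(x * sinh \<gamma> - y * sinh z) *
      (x - \<delta> * sinh \<gamma>)\<close>, nonzero by the two assumptions.\<close>
    unfolding t_fun_phi[OF phi_defined[OF a(2)]] rat_eq_None_iff by simp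
qed

text \<open>The matrix is invertible, so \<open>s_next\<close> is total and only the definedness of
  \<open>s\<close> matters.\<close>

lemma generically_defined_S_of_s:
  "generically_defined (\<lambda>p. Option.bind (s_fun \<delta> \<gamma> z p) (s_next \<delta> \<gamma> z))"
proof (rule generically_definedI[OF squares_neq])
  fix x y
  assume a: "x * sinh \<gamma> - y * sinh z \<noteq> 0" "x * sinh z - y * sinh \<gamma> \<noteq> 0"
  have "s_next \<delta> \<gamma> z \<sigma> \<noteq> None" for \<sigma>
    using S_hom_nonzero[OF \<delta> squares_neq _ hc_nonzero] nd
    by (simp add: s_next_eq rat_eq_None_iff nondegenerate_def)
  then show "Option.bind (s_fun \<delta> \<gamma> z (Fin x, Fin y)) (s_next \<delta> \<gamma> z) \<noteq> None"
    using s_fun_defined[OF a] by auto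
qed

lemma generically_defined_T_of_st:
  "generically_defined (\<lambda>p. Option.bind (s_fun \<delta> \<gamma> z p)
     (\<lambda>\<sigma>. Option.bind (t_fun \<delta> \<gamma> z p) (t_next \<delta> \<gamma> z \<sigma>)))"
proof (rule generically_definedI[OF squares_neq])
  let ?g = "sinh \<gamma>" and ?k = "sinh z"
  fix x y
  assume a: "x * ?g - y * ?k \<noteq> 0" "x * ?k - y * ?g \<noteq> 0"
    and b: "x\<^sup>2 \<noteq> ?k\<^sup>2 * \<delta>\<^sup>2" "(x - y)\<^sup>2 \<noteq> \<delta>\<^sup>2 * (?g - ?k)\<^sup>2"
  have x: "x \<noteq> \<delta> * ?k"
    using b(1) by (auto simp: power_mult_distrib)
  have "?g + ?k \<noteq> 0" "?g\<^sup>2 + ?k\<^sup>2 \<noteq> 0"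
    using nd by (auto simp: nondegenerate_def power2_eq_iff add_eq_0_iff2)
  \<comment> \<open>This product is the value of \<open>T_hom_sum\<close> at the given point:
    substituting \<open>s_hom\<close> turns its middle factor into a multiple of
    \<open>\<delta>^2 * (g - k)^2 - (x - y)^2\<close>, and \<open>t0\<close> is
    \<open>x - \<delta> * k\<close>.\<close>
  then have "(?g + ?k) * (\<delta>\<^sup>2 * (?g\<^sup>2 + ?k\<^sup>2) * (\<delta>\<^sup>2 * (?g - ?k)\<^sup>2 - (x - y)\<^sup>2)) * (x - \<delta> * ?k) \<noteq> 0"
    using \<delta> x b(2) by simp
  moreover obtain s1 s0 where s: "s_hom \<delta> ?g ?k (x, 1) (y, 1) = (s1, s0)"
    by (metis surj_pair)
  then have s': "x\<^sup>2 + y\<^sup>2 - \<delta>\<^sup>2 * (?g\<^sup>2 + ?k\<^sup>2) = s1" "\<delta>\<^sup>2 * (x * ?k - y * ?g) * (y * ?k - x * ?g) = s0"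
    by simp_all
  moreover have "2 * s0 - \<delta>\<^sup>2 * s1 * (?g - ?k)\<^sup>2 =
      \<delta>\<^sup>2 * (?g\<^sup>2 + ?k\<^sup>2) * (\<delta>\<^sup>2 * (?g - ?k)\<^sup>2 - (x - y)\<^sup>2)"
    unfolding s'[symmetric] by algebra
  moreover obtain t1 where t: "t_hom \<delta> ?g ?k (x, 1) (y, 1) = (t1, x - \<delta> * ?k)"
    by simp
  ultimately have "fst (T_hom \<delta> ?g ?k (s_hom \<delta> ?g ?k (x, 1) (y, 1)) (t_hom \<delta> ?g ?k (x, 1) (y, 1))) +
      snd (T_hom \<delta> ?g ?k (s_hom \<delta> ?g ?k (x, 1) (y, 1)) (t_hom \<delta> ?g ?k (x, 1) (y, 1))) \<noteq> 0"
    unfolding s t T_hom_sum by simp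
  then show "Option.bind (s_fun \<delta> \<gamma> z (Fin x, Fin y))
      (\<lambda>\<sigma>. Option.bind (t_fun \<delta> \<gamma> z (Fin x, Fin y)) (t_next \<delta> \<gamma> z \<sigma>)) \<noteq> None"
    unfolding t_next_s_fun_t_fun[OF s_fun_defined[OF a] t_fun_defined[OF x]] rat_eq_None_iff hc.simps
    by auto
qed

end

theorem mainTheorem4:
  fixes \<delta> \<gamma> z :: complex
  assumes "\<delta> \<noteq> 0"
  defines "\<phi> \<equiv> phi \<delta> \<gamma> z"
    and "C \<equiv> pencil_curve \<delta> \<gamma> z"
    and "s \<equiv> s_fun \<delta> \<gamma> z"
    and "t \<equiv> t_fun \<delta> \<gamma> z"
    and "S \<equiv> s_next \<delta> \<gamma> z"
    and "T \<equiv> t_next \<delta> \<gamma> z"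
  defines "s_bar \<equiv> (\<lambda>p. Option.bind (\<phi> p) s)"
    and "t_bar \<equiv> (\<lambda>p. Option.bind (\<phi> p) t)"
    and "S_of_s \<equiv> (\<lambda>p. Option.bind (s p) S)"
    and "T_of_st \<equiv> (\<lambda>p. Option.bind (s p) (\<lambda>\<sigma>. Option.bind (t p) (T \<sigma>)))"
  shows "(\<exists>\<tau>. acts_on_pencil \<phi> C \<tau> \<and> (nondegenerate \<gamma> z \<longrightarrow> bij \<tau>))
    \<and> (\<forall>p \<sigma> c. s p = Some \<sigma> \<longrightarrow> (p \<in> C c \<longleftrightarrow> c = \<sigma>))
    \<and> agree s_bar S_of_s
    \<and> agree t_bar T_of_st
    \<and> riccati_cascade S T
    \<and> (nondegenerate \<gamma> z \<longrightarrow>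
         generically_defined s_bar \<and> generically_defined S_of_s
         \<and> generically_defined t_bar \<and> generically_defined T_of_st
         \<and> nondegenerate_riccati S \<and> (MOST \<sigma>. nondegenerate_riccati (T \<sigma>)))"
  unfolding assms(2-)
  using ex_acts_on_pencil[OF assms(1)] pencil_curve_s_fun agree_s agree_t riccati_cascade_next
    generically_defined_s_bar[OF assms(1)] generically_defined_S_of_s[OF assms(1)]
    generically_defined_t_bar[OF assms(1)] generically_defined_T_of_st[OF assms(1)]
    nondegenerate_riccati_s_next[OF assms(1)] MOST_nondegenerate_riccati_t_next
  by (intro conjI impI allI) auto

end
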